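(* Suppose $1<p<\infty$ and $1\le q\le\infty$. The set function $\Gamma\mapsto \mathrm{Mod}_{p,q}(\Gamma)$, $\Gamma\subset\Gamma_{\rm rect}$, has the following properties. (i) $\mathrm{Mod}_{p,q}(\emptyset)=0$. (ii) If $\Gamma_1\subset\Gamma_2\subset\Gamma_{\rm rect}$, then $\mathrm{Mod}_{p,q}(\Gamma_1)\le \mathrm{Mod}_{p,q}(\Gamma_2)$. (iii) Suppose $1\le q\le p$. Then for every sequence $\Gamma_1,\Gamma_2,\ldots\subset\Gamma_{\rm rect}$, $$\mathrm{Mod}_{p,q}\Big(\bigcup_{i=1}^\infty\Gamma_i\Big)^{q/p}\le\sum_{i=1}^\infty \mathrm{Mod}_{p,q}(\Gamma_i)^{q/p}.$$ (iv) Suppose $p<q\le\infty$. Then for every sequence $\Gamma_1,\Gamma_2,\ldots\subset\Gamma_{\rm rect}$, $$\mathrm{Mod}_{p,q}\Big(\bigcup_{i=1}^\infty\Gamma_i\Big)\le\sum_{i=1}^\infty \mathrm{Mod}_{p,q}(\Gamma_i).$$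
   Context: Setting: $(X,d)$ is a complete metric space endowed with a nontrivial Borel regular measure $\mu$ that is finite and nonzero on nonempty bounded open sets. Lorentz quasinorm: for a $\mu$-measurable $f:X\to[-\infty,\infty]$ let $\mu_{[f]}(t)=\mu(\{x\in X:|f(x)|>t\})$, $t\ge0$, and $f^*(t)=\inf\{v\ge 0:\mu_{[f]}(v)\le t\}$, $t\ge0$. For $1<p<\infty$ put $\|f\|_{L^{p,q}(X,\mu)}=\left(\int_0^\infty (t^{1/p}f^*(t))^q\,\frac{dt}{t}\right)^{1/q}$ if $1\le q<\infty$, and $\|f\|_{L^{p,\infty}(X,\mu)}=\sup_{t>0}t\,\mu_{[f]}(t)^{1/p}=\sup_{s>0}s^{1/p}f^*(s)$. $L^{p,q}(X,\mu)$ is the set of $\mu$-measurable $f$ with $\|f\|_{L^{p,q}(X,\mu)}<\infty$. Modulus: a curve in $X$ is rectifiable if it has finite length; a rectifiable curve $\gamma$ is parametrized by arc length on $[0,\ell(\gamma)]$, $\ell(\gamma)$ its length, and $\int_\gamma\rho=\int_0^{\ell(\gamma)}\rho(\gamma(s))\,ds$ for Borel $\rho\ge0$. $\Gamma_{\rm rect}$ is the family of all nonconstant rectifiable curves in $X$. For $\Gamma\subset\Gamma_{\rm rect}$, $F(\Gamma)$ is the family of all Borel functions $\rho:X\to[0,\infty]$ with $\int_\gamma\rho\ge1$ for every $\gamma\in\Gamma$, and $\mathrm{Mod}_{p,q}(\Gamma)=\inf_{\rho\in F(\Gamma)}\|\rho\|_{L^{p,q}(X,\mu)}^p$. *)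

theory Defs
  imports "HOL-Analysis.Analysis"
begin

section \<open>Powers of extended nonnegative reals\<close>

text \<open>Only used with a positive exponent, so that \<open>0\<close> and \<open>\<infinity>\<close> are mapped to themselves.\<close>

definition ennpowr :: "ennreal \<Rightarrow> real \<Rightarrow> ennreal"  (infixr "epowr" 80)
  where "x epowr a = (if x = \<infinity> then \<infinity> else ennreal (enn2real x powr a))"

section \<open>Borel regular measures\<close>

text \<open>
  The \<open>\<mu>\<close>-measurable sets are \<open>sets M\<close>; this \<open>\<sigma>\<close>-algebra may be strictly larger than the Borel
  one. A Borel regular outer measure is covered by restricting it to its
  Caratheodory measurable sets.
\<close>

definition borel_regular :: "'a::topological_space measure \<Rightarrow> bool"
  where "borel_regular M \<longleftrightarrow>
    space M = UNIV \<and> sets borel \<subseteq> sets M \<and>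
    (\<forall>A\<in>sets M. \<exists>B\<in>sets borel. A \<subseteq> B \<and> emeasure M B = emeasure M A)"

section \<open>Lorentz quasinorms\<close>

definition distr_fun :: "'a measure \<Rightarrow> ('a \<Rightarrow> ereal) \<Rightarrow> real \<Rightarrow> ennreal"
  where "distr_fun M f t = emeasure M {x\<in>space M. \<bar>f x\<bar> > ereal t}"

text \<open>The infimum is taken in \<open>[0,\<infinity>]\<close>, so that it is \<open>\<infinity>\<close> for the empty set.\<close>

definition decr_rearr :: "'a measure \<Rightarrow> ('a \<Rightarrow> ereal) \<Rightarrow> real \<Rightarrow> ennreal"
  where "decr_rearr M f t = (INF v\<in>{v. 0 \<le> v \<and> distr_fun M f v \<le> ennreal t}. ennreal v)"

definition lorentz_norm :: "'a measure \<Rightarrow> real \<Rightarrow> ennreal \<Rightarrow> ('a \<Rightarrow> ereal) \<Rightarrow> ennreal"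
  where "lorentz_norm M p q f =
    (if q = \<infinity> then (SUP t\<in>{0<..}. ennreal t * distr_fun M f t epowr (1 / p))
     else (\<integral>\<^sup>+t\<in>{0<..}. ((ennreal (t powr (1 / p)) * decr_rearr M f t) epowr enn2real q / ennreal t)
             \<partial>lborel) epowr (1 / enn2real q))"

section \<open>Rectifiable curves\<close>

text \<open>
  A curve is a \<^const>\<open>path\<close>, i.e. a continuous map on \<open>[0,1]\<close>; no notion below depends on the values
  outside of \<open>[0,1]\<close>.
\<close>

definition partition_points :: "real \<Rightarrow> real \<Rightarrow> nat \<Rightarrow> (nat \<Rightarrow> real) \<Rightarrow> bool"
  where "partition_points a b n t \<longleftrightarrow> t 0 = a \<and> t n = b \<and> (\<forall>i<n. t i \<le> t (Suc i))"

definition curve_length :: "(real \<Rightarrow> 'a::metric_space) \<Rightarrow> real \<Rightarrow> real \<Rightarrow> ennreal"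
  where "curve_length g a b =
    (SUP (n, t)\<in>{(n, t). partition_points a b n t}. \<Sum>i<n. ennreal (dist (g (t i)) (g (t (Suc i)))))"

definition rectifiable :: "(real \<Rightarrow> 'a::metric_space) \<Rightarrow> bool"
  where "rectifiable g \<longleftrightarrow> path g \<and> curve_length g 0 1 < \<infinity>"

text \<open>
  For \<open>0 \<le> s \<le> \<ell>(g)\<close> there is a \<open>u\<close> such that the restriction of \<open>g\<close> to \<open>[0,u]\<close> has length \<open>s\<close>, and
  \<open>g u\<close> (though in general not \<open>u\<close>) is unique. Values at other \<open>s\<close> are irrelevant.
\<close>

definition arc_param :: "(real \<Rightarrow> 'a::metric_space) \<Rightarrow> real \<Rightarrow> 'a"
  where "arc_param g s = (THE x. \<exists>u\<in>{0..1}. curve_length g 0 u = ennreal s \<and> x = g u)"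

definition line_integral :: "(real \<Rightarrow> 'a::metric_space) \<Rightarrow> ('a \<Rightarrow> ennreal) \<Rightarrow> ennreal"
  where "line_integral g \<rho> =
    (\<integral>\<^sup>+s\<in>{0..enn2real (curve_length g 0 1)}. \<rho> (arc_param g s) \<partial>lborel)"

definition Gamma_rect :: "(real \<Rightarrow> 'a::metric_space) set"
  where "Gamma_rect = {g. rectifiable g \<and> \<not> g constant_on {0..1}}"

section \<open>The modulus\<close>

definition admissible :: "(real \<Rightarrow> 'a::metric_space) set \<Rightarrow> ('a \<Rightarrow> ennreal) set"
  where "admissible \<Gamma> = {\<rho>\<in>borel_measurable borel. \<forall>g\<in>\<Gamma>. line_integral g \<rho> \<ge> 1}"

definition Mod_pq :: "'a::metric_space measure \<Rightarrow> real \<Rightarrow> ennreal \<Rightarrow> (real \<Rightarrow> 'a) set \<Rightarrow> ennreal"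
  where "Mod_pq M p q \<Gamma> =
    (INF \<rho>\<in>admissible \<Gamma>. lorentz_norm M p q (\<lambda>x. enn2ereal (\<rho> x)) epowr p)"

end

theory Submission
  imports Defs
begin

text \<open>
  The pointwise supremum of densities that are admissible for the families \<open>\<Gamma>\<^sub>i\<close> is admissible for
  their union. Countable subadditivity of (a power of) the modulus thus reduces to an estimate for the
  Lorentz quasinorm of \<open>\<rho> = sup\<^sub>i \<rho>\<^sub>i\<close> by the quasinorms of the \<open>\<rho>\<^sub>i\<close>.

  This estimate becomes transparent when the quasinorm is expressed by the distribution function. By
  the layer cake formula \<open>layer_cake_decr_rearr\<close>, for \<open>q < \<infinity>\<close>, the \<open>q\<close>-th power of the quasinorm of
  \<open>f\<close> is the integral of \<open>p s\<^sup>q\<^sup>-\<^sup>1 \<mu>\<^sub>f(s)\<^sup>q\<^sup>/\<^sup>p\<close> over \<open>s > 0\<close>, where \<open>\<mu>\<^sub>f\<close> is the distribution function of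
  \<open>f\<close>. Since \<open>{\<rho> > s}\<close> is the union of the sets \<open>{\<rho>\<^sub>i > s}\<close>, the distribution function of \<open>\<rho>\<close> is at most
  the sum of those of the \<open>\<rho>\<^sub>i\<close>. If \<open>q \<le> p\<close>, the power \<open>q / p \<le> 1\<close> is subadditive, and integration yields
  subadditivity of the \<open>q\<close>-th power of the quasinorm (\<open>lorentz_norm_SUP_epowr_q_le\<close>). If
  \<open>p < q < \<infinity>\<close>, the \<open>p\<close>-th power of the quasinorm is an \<open>L\<^sup>q\<^sup>/\<^sup>p\<close> norm of \<open>\<mu>\<^sub>f\<close>, and Minkowski's inequality
  for countable sums yields subadditivity of the \<open>p\<close>-th power (\<open>lorentz_norm_SUP_epowr_p_le\<close>). For
  \<open>q = \<infinity>\<close> that power is the supremum of \<open>s\<^sup>p \<mu>\<^sub>f(s)\<close>, and the estimate is immediate.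
\<close>

section \<open>Real powers on the extended half-line\<close>

lemma epowr_ennreal: "0 \<le> x \<Longrightarrow> ennreal x epowr a = ennreal (x powr a)"
  by (simp add: ennpowr_def)

lemma epowr_top [simp]: "\<infinity> epowr a = \<infinity>" "top epowr a = top"
  by (auto simp: ennpowr_def)

lemma epowr_0 [simp]: "0 epowr a = 0"
  by (simp add: ennpowr_def)

lemma epowr_1 [simp]: "x epowr 1 = x"
  by (cases x) (auto simp: ennpowr_def)

lemma epowr_epowr:
  shows "(x epowr a) epowr b = x epowr (a * b)"
  by (cases x) (auto simp: epowr_ennreal powr_powr)

lemma epowr_mult:
  assumes "0 < a"
  shows "(x * y) epowr a = x epowr a * y epowr a"
proof (cases "x = top \<or> y = top")
  case True
  have *: "z epowr a = 0 \<longleftrightarrow> z = 0" for z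
    by (cases z) (auto simp: epowr_ennreal)
  show ?thesis
    using True by (auto simp: ennreal_top_mult ennreal_mult_top *)
next
  case False
  then show ?thesis
    by (cases x; cases y) (auto simp: epowr_ennreal powr_mult simp flip: ennreal_mult)
qed

lemma epowr_mono:
  assumes "x \<le> y" "0 \<le> a"
  shows "x epowr a \<le> y epowr a"
  using assms by (cases x; cases y) (auto simp: epowr_ennreal top_unique intro!: ennreal_leI powr_mono2)

lemma epowr_inverse:
  assumes "0 < a"
  shows "(x epowr a) epowr (1 / a) = x" "(x epowr (1 / a)) epowr a = x"
  using assms by (simp_all add: epowr_epowr)

text \<open>
  A power with positive exponent is an order automorphism of \<open>[0,\<infinity>]\<close>, with the reciprocal exponent
  as its inverse. It therefore commutes with arbitrary infima and suprema, also over an empty index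
  set.
\<close>

lemma epowr_INF:
  assumes "0 < a"
  shows "(INF i\<in>I. f i) epowr a = (INF i\<in>I. f i epowr a)"
proof (rule antisym)
  show "(INF i\<in>I. f i) epowr a \<le> (INF i\<in>I. f i epowr a)"
    using assms by (intro INF_greatest epowr_mono INF_lower) auto
  have "(INF i\<in>I. f i epowr a) epowr (1 / a) \<le> f i" if "i \<in> I" for i
  proof -
    have "(INF i\<in>I. f i epowr a) epowr (1 / a) \<le> (f i epowr a) epowr (1 / a)"
      using that assms by (intro epowr_mono INF_lower) auto
    then show ?thesis
      using assms by (simp add: epowr_inverse)
  qed
  then have "((INF i\<in>I. f i epowr a) epowr (1 / a)) epowr a \<le> (INF i\<in>I. f i) epowr a"
    using assms by (intro epowr_mono INF_greatest) auto
  then show "(INF i\<in>I. f i epowr a) \<le> (INF i\<in>I. f i) epowr a"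
    using assms by (simp add: epowr_inverse)
qed

lemma epowr_SUP:
  assumes "0 < a"
  shows "(SUP i\<in>I. f i) epowr a = (SUP i\<in>I. f i epowr a)"
proof (rule antisym)
  show "(SUP i\<in>I. f i epowr a) \<le> (SUP i\<in>I. f i) epowr a"
    using assms by (intro SUP_least epowr_mono SUP_upper) auto
  have "f i \<le> (SUP i\<in>I. f i epowr a) epowr (1 / a)" if "i \<in> I" for i
  proof -
    have "(f i epowr a) epowr (1 / a) \<le> (SUP i\<in>I. f i epowr a) epowr (1 / a)"
      using that assms by (intro epowr_mono SUP_upper) auto
    then show ?thesis
      using assms by (simp add: epowr_inverse)
  qed
  then have "(SUP i\<in>I. f i) epowr a \<le> ((SUP i\<in>I. f i epowr a) epowr (1 / a)) epowr a"
    using assms by (intro epowr_mono SUP_least) auto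
  then show "(SUP i\<in>I. f i) epowr a \<le> (SUP i\<in>I. f i epowr a)"
    using assms by (simp add: epowr_inverse)
qed

lemma measurable_epowr [measurable]:
  assumes [measurable]: "f \<in> borel_measurable M"
  shows "(\<lambda>x. f x epowr a) \<in> borel_measurable M"
  unfolding ennpowr_def by measurable

text \<open>
  After scaling to \<open>x + y = 1\<close> this is the remark that \<open>u \<le> u\<^sup>a\<close> and \<open>v \<le> v\<^sup>a\<close> for \<open>u, v\<close> in \<open>[0,1]\<close>
  with \<open>u + v = 1\<close>.
\<close>

lemma powr_add_le:
  fixes x y a :: real
  assumes "0 \<le> x" "0 \<le> y" "0 < a" "a \<le> 1"
  shows "(x + y) powr a \<le> x powr a + y powr a"
proof (cases "x + y = 0")
  case False
  define u v where "u = x / (x + y)" and "v = y / (x + y)"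
  have uv: "0 \<le> u" "u \<le> 1" "0 \<le> v" "v \<le> 1" "u + v = 1" "x = (x + y) * u" "y = (x + y) * v"
    using False assms by (auto simp: u_def v_def divide_simps)
  have le: "t \<le> t powr a" if "0 \<le> t" "t \<le> 1" for t :: real
    using powr_mono'[of a 1 t] that assms by simp
  have "(x + y) powr a * 1 \<le> (x + y) powr a * (u powr a + v powr a)"
    using le[of u] le[of v] uv by (intro mult_left_mono) auto
  also have "\<dots> = ((x + y) * u) powr a + ((x + y) * v) powr a"
    using uv(1,3) assms by (simp add: powr_mult distrib_left)
  finally show ?thesis
    by (simp flip: uv(6,7))
qed (use assms in auto)

lemma epowr_add_le:
  assumes "0 < a" "a \<le> 1"
  shows "(x + y) epowr a \<le> x epowr a + y epowr a"
  using assms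
  by (cases x; cases y) (auto simp: epowr_ennreal powr_add_le simp flip: ennreal_plus)

lemma epowr_suminf_le:
  fixes x :: "nat \<Rightarrow> ennreal"
  assumes "0 < a" "a \<le> 1"
  shows "(\<Sum>i. x i) epowr a \<le> (\<Sum>i. x i epowr a)"
proof -
  have "(\<Sum>i<n. x i) epowr a \<le> (\<Sum>i<n. x i epowr a)" for n
  proof (induction n)
    case (Suc n)
    have "(\<Sum>i<Suc n. x i) epowr a \<le> (\<Sum>i<n. x i) epowr a + x n epowr a"
      using epowr_add_le[OF assms] by simp
    also have "\<dots> \<le> (\<Sum>i<Suc n. x i epowr a)"
      using Suc by (simp add: add_right_mono)
    finally show ?case .
  qed simp
  then have "(SUP n. (\<Sum>i<n. x i) epowr a) \<le> (SUP n. \<Sum>i<n. x i epowr a)"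
    by (intro SUP_mono) auto
  then show ?thesis
    using assms by (simp add: suminf_eq_SUP epowr_SUP)
qed

section \<open>Minkowski's inequality for nonnegative functions\<close>

text \<open>
  Convexity of \<open>t \<mapsto> t\<^sup>r\<close>, applied to the convex combination
  \<open>(x + y) / (A + B) = A / (A + B) \<cdot> (x / A) + B / (A + B) \<cdot> (y / B)\<close>. The point of the weights is that
  both terms on the right become computable when \<open>x\<close> and \<open>y\<close> are integrated, and that for
  \<open>\<integral>x\<^sup>r \<le> A\<^sup>r\<close> and \<open>\<integral>y\<^sup>r \<le> B\<^sup>r\<close> the resulting bound is exactly \<open>(A + B)\<^sup>r\<close>.
\<close>

lemma powr_add_weighted_le:
  fixes x y A B r :: real
  assumes "0 \<le> x" "0 \<le> y" "0 < A" "0 < B" "1 \<le> r"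
  shows "(x + y) powr r \<le> (A + B) powr (r - 1) * (x powr r / A powr (r - 1) + y powr r / B powr (r - 1))"
proof -
  have zero: "y powr r \<le> (A + B) powr (r - 1) * (y powr r / B powr (r - 1))"
    if "0 < A" "0 < B" for A B y :: real
  proof -
    have "B powr (r - 1) \<le> (A + B) powr (r - 1)"
      using that assms by (intro powr_mono2) auto
    then have "y powr r * B powr (r - 1) \<le> (A + B) powr (r - 1) * y powr r"
      by (metis mult.commute mult_left_mono powr_ge_zero)
    then show ?thesis
      using that by (simp add: field_simps)
  qed
  \<comment> \<open>If one summand vanishes, the bound is monotonicity of \<open>t \<mapsto> t\<^sup>r\<^sup>-\<^sup>1\<close>; otherwise it is convexity on \<open>(0,\<infinity>)\<close>.\<close>
  consider "x = 0" | "y = 0" | "0 < x" "0 < y"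
    using assms by force
  then show ?thesis
  proof cases
    case 3
    have r: "z powr r = z * z powr (r - 1)" if "0 < z" for z :: real
      using powr_add[of z 1 "r - 1"] that by simp
    define s where "s = A / (A + B)"
    have s: "0 < s" "s < 1" "1 - s = B / (A + B)"
      using assms by (auto simp: s_def field_simps)
    have eq: "(1 - s) *\<^sub>R (y / B) + s *\<^sub>R (x / A) = (x + y) / (A + B)"
      unfolding s(3) using assms by (simp add: s_def add_divide_distrib)
    have "((1 - s) *\<^sub>R (y / B) + s *\<^sub>R (x / A)) powr r \<le> (1 - s) * (y / B) powr r + s * (x / A) powr r"
      using 3 assms s by (intro convex_onD[OF powr_convex]) auto
    then have "(x + y) powr r / (A + B) powr r
        \<le> B / (A + B) * (y powr r / B powr r) + A / (A + B) * (x powr r / A powr r)"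
      unfolding eq unfolding s(3) unfolding s_def using 3 assms by (simp add: powr_divide)
    then have "(A + B) powr r * ((x + y) powr r / (A + B) powr r)
        \<le> (A + B) powr r * (B / (A + B) * (y powr r / B powr r) + A / (A + B) * (x powr r / A powr r))"
      by (intro mult_left_mono) auto
    also have "\<dots> = (A + B) powr (r - 1) * (x powr r / A powr (r - 1) + y powr r / B powr (r - 1))"
      using assms by (simp add: r[of A] r[of B] r[of "A + B"] distrib_left add.commute)
    finally show ?thesis
      using assms by simp
  qed (use zero[of B A x] zero[of A B y] assms in \<open>auto simp: add.commute\<close>)
qed

text \<open>
  The weighted inequality is integrated for arbitrary positive reals \<open>A\<close>, \<open>B\<close> that bound the two
  norms. Letting them decrease to the norms avoids a separate treatment of vanishing norms.
\<close>

lemma minkowski_add: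
  assumes [measurable]: "f \<in> borel_measurable M" "g \<in> borel_measurable M"
    and "1 \<le> r"
  shows "(\<integral>\<^sup>+x. (f x + g x) epowr r \<partial>M) epowr (1 / r)
    \<le> (\<integral>\<^sup>+x. f x epowr r \<partial>M) epowr (1 / r) + (\<integral>\<^sup>+x. g x epowr r \<partial>M) epowr (1 / r)"
    (is "?L \<le> ?F + ?G")
proof -
  have *: "?L \<le> ennreal A + ennreal B"
    if AB: "0 < A" "0 < B" "?F \<le> ennreal A" "?G \<le> ennreal B" for A B
  proof -
    have bound: "(\<integral>\<^sup>+x. h x epowr r \<partial>M) \<le> ennreal (C powr r)"
      if "(\<integral>\<^sup>+x. h x epowr r \<partial>M) epowr (1 / r) \<le> ennreal C" "0 < C" for h C
      using epowr_mono[OF that(1), of r] that \<open>1 \<le> r\<close> by (simp add: epowr_inverse epowr_ennreal)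
    have r: "z powr r / z powr (r - 1) = z" if "0 < z" for z :: real
      using powr_add[of z 1 "r - 1"] that by simp
    have pt: "(x + y) epowr r \<le> ennreal ((A + B) powr (r - 1)) *
        (ennreal (1 / A powr (r - 1)) * x epowr r + ennreal (1 / B powr (r - 1)) * y epowr r)" for x y
    proof (cases "x = top \<or> y = top")
      case True
      then show ?thesis
        using AB by (auto simp: ennreal_mult_top)
    next
      case False
      then show ?thesis
        using powr_add_weighted_le[of "enn2real x" "enn2real y" A B r] AB \<open>1 \<le> r\<close>
        by (cases x; cases y)
          (auto simp: epowr_ennreal simp flip: ennreal_plus ennreal_mult intro!: ennreal_leI)
    qed
    have "(\<integral>\<^sup>+x. (f x + g x) epowr r \<partial>M)
        \<le> (\<integral>\<^sup>+x. ennreal ((A + B) powr (r - 1)) *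
          (ennreal (1 / A powr (r - 1)) * f x epowr r + ennreal (1 / B powr (r - 1)) * g x epowr r) \<partial>M)"
      by (intro nn_integral_mono pt)
    also have "\<dots> = ennreal ((A + B) powr (r - 1)) *
        (ennreal (1 / A powr (r - 1)) * (\<integral>\<^sup>+x. f x epowr r \<partial>M)
          + ennreal (1 / B powr (r - 1)) * (\<integral>\<^sup>+x. g x epowr r \<partial>M))"
      by (simp add: nn_integral_cmult nn_integral_add)
    also have "\<dots> \<le> ennreal ((A + B) powr (r - 1)) *
        (ennreal (1 / A powr (r - 1)) * ennreal (A powr r)
          + ennreal (1 / B powr (r - 1)) * ennreal (B powr r))"
      using AB by (intro mult_left_mono add_mono bound) auto
    also have "\<dots> = ennreal ((A + B) powr (r - 1) * (A powr r / A powr (r - 1) + B powr r / B powr (r - 1)))"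
      by (simp flip: ennreal_plus ennreal_mult)
    also have "\<dots> = ennreal ((A + B) powr r)"
      using AB powr_add[of "A + B" 1 "r - 1"] by (simp add: r mult.commute)
    finally have "?L \<le> ennreal ((A + B) powr r) epowr (1 / r)"
      using \<open>1 \<le> r\<close> by (intro epowr_mono) auto
    also have "\<dots> = ennreal A + ennreal B"
      using AB \<open>1 \<le> r\<close> by (simp add: epowr_ennreal powr_powr)
    finally show ?thesis .
  qed
  show ?thesis
  proof (rule ennreal_le_epsilon)
    fix e :: real
    assume fin: "?F + ?G < top" and "0 < e"
    define A B where "A = enn2real ?F + e / 2" and "B = enn2real ?G + e / 2"
    have A: "ennreal A = ?F + ennreal (e / 2)" and B: "ennreal B = ?G + ennreal (e / 2)"
      using fin \<open>0 < e\<close> by (auto simp: A_def B_def ennreal_plus)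
    have "?L \<le> ennreal A + ennreal B"
      using \<open>0 < e\<close> by (intro *) (auto simp: A B, auto simp: A_def B_def add_nonneg_pos)
    also have "\<dots> = ?F + ?G + (ennreal (e / 2) + ennreal (e / 2))"
      by (simp add: A B ac_simps)
    also have "ennreal (e / 2) + ennreal (e / 2) = ennreal e"
      using \<open>0 < e\<close> by (simp flip: ennreal_plus)
    finally show "?L \<le> ?F + ?G + ennreal e" .
  qed
qed

lemma minkowski_suminf:
  fixes f :: "nat \<Rightarrow> 'a \<Rightarrow> ennreal"
  assumes [measurable]: "\<And>i. f i \<in> borel_measurable M" and "1 \<le> r"
  shows "(\<integral>\<^sup>+x. (\<Sum>i. f i x) epowr r \<partial>M) epowr (1 / r)
    \<le> (\<Sum>i. (\<integral>\<^sup>+x. f i x epowr r \<partial>M) epowr (1 / r))"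
proof -
  have fin: "(\<integral>\<^sup>+x. (\<Sum>i<n. f i x) epowr r \<partial>M) epowr (1 / r)
      \<le> (\<Sum>i<n. (\<integral>\<^sup>+x. f i x epowr r \<partial>M) epowr (1 / r))" for n
  proof (induction n)
    case (Suc n)
    have "(\<integral>\<^sup>+x. (\<Sum>i<Suc n. f i x) epowr r \<partial>M) epowr (1 / r)
        \<le> (\<integral>\<^sup>+x. (\<Sum>i<n. f i x) epowr r \<partial>M) epowr (1 / r) + (\<integral>\<^sup>+x. f n x epowr r \<partial>M) epowr (1 / r)"
      using minkowski_add[of "\<lambda>x. \<Sum>i<n. f i x" M "f n" r] \<open>1 \<le> r\<close> by simp
    then show ?case
      using Suc by (simp add: add_right_mono order_trans)
  qed simp
  have "(\<integral>\<^sup>+x. (\<Sum>i. f i x) epowr r \<partial>M) = (\<integral>\<^sup>+x. (SUP n. (\<Sum>i<n. f i x) epowr r) \<partial>M)"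
    using \<open>1 \<le> r\<close> by (simp add: suminf_eq_SUP epowr_SUP)
  also have "\<dots> = (SUP n. \<integral>\<^sup>+x. (\<Sum>i<n. f i x) epowr r \<partial>M)"
    using \<open>1 \<le> r\<close>
    by (intro nn_integral_monotone_convergence_SUP)
      (auto simp: incseq_def le_fun_def intro!: epowr_mono sum_mono2)
  finally have "(\<integral>\<^sup>+x. (\<Sum>i. f i x) epowr r \<partial>M) epowr (1 / r)
      = (SUP n. (\<integral>\<^sup>+x. (\<Sum>i<n. f i x) epowr r \<partial>M) epowr (1 / r))"
    using \<open>1 \<le> r\<close> by (simp add: epowr_SUP)
  also have "\<dots> \<le> (SUP n. \<Sum>i<n. (\<integral>\<^sup>+x. f i x epowr r \<partial>M) epowr (1 / r))"
    using fin by (intro SUP_mono) auto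
  finally show ?thesis
    by (simp add: suminf_eq_SUP)
qed

section \<open>The layer cake formula for the decreasing rearrangement\<close>

lemma distr_fun_antimono:
  assumes [measurable]: "f \<in> borel_measurable M" and "s \<le> t"
  shows "distr_fun M f t \<le> distr_fun M f s"
  unfolding distr_fun_def
proof (rule emeasure_mono)
  show "{x \<in> space M. ereal t < \<bar>f x\<bar>} \<subseteq> {x \<in> space M. ereal s < \<bar>f x\<bar>}"
    using \<open>s \<le> t\<close> by (auto intro: le_less_trans[of "ereal s" "ereal t"])
qed measurable

lemma borel_measurable_distr_fun:
  assumes "f \<in> borel_measurable M"
  shows "distr_fun M f \<in> borel_measurable borel"
proof (rule borel_measurableI_greater)
  fix y
  have "is_interval {t. y < distr_fun M f t}"
    unfolding is_interval_1 using distr_fun_antimono[OF assms] by (auto intro: less_le_trans)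
  then show "{t \<in> space borel. y < distr_fun M f t} \<in> sets borel"
    using real_interval_borel_measurable by simp
qed

text \<open>
  The decreasing rearrangement is a generalized inverse of the distribution function. The implication
  from right to left is where right continuity of the distribution function enters: it gives a level
  strictly above \<open>s\<close> at which the distribution function still exceeds \<open>t\<close>.
\<close>

lemma less_decr_rearr_iff:
  assumes [measurable]: "f \<in> borel_measurable M" and "0 \<le> s"
  shows "ennreal s < decr_rearr M f t \<longleftrightarrow> ennreal t < distr_fun M f s"
proof
  assume less: "ennreal s < decr_rearr M f t"
  show "ennreal t < distr_fun M f s"
  proof (rule ccontr)
    assume "\<not> ennreal t < distr_fun M f s"
    then have "decr_rearr M f t \<le> ennreal s"
      unfolding decr_rearr_def using \<open>0 \<le> s\<close> by (intro INF_lower) auto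
    then show False
      using less by simp
  qed
next
  assume less: "ennreal t < distr_fun M f s"
  have "distr_fun M f s = (SUP n. distr_fun M f (s + 1 / Suc n))"
  proof -
    have "(SUP n. distr_fun M f (s + 1 / Suc n))
        = emeasure M (\<Union>n. {x \<in> space M. ereal (s + 1 / Suc n) < \<bar>f x\<bar>})"
      unfolding distr_fun_def
    proof (rule SUP_emeasure_incseq)
      have "s + 1 / Suc n \<le> s + 1 / Suc m" if "m \<le> n" for m n
        using that by (auto intro!: divide_left_mono)
      then show "incseq (\<lambda>n. {x \<in> space M. ereal (s + 1 / Suc n) < \<bar>f x\<bar>})"
        unfolding incseq_def by (fastforce intro: le_less_trans[rotated])
    qed auto
    also have "(\<Union>n. {x \<in> space M. ereal (s + 1 / Suc n) < \<bar>f x\<bar>}) = {x \<in> space M. ereal s < \<bar>f x\<bar>}"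
    proof (intro subset_antisym subsetI)
      fix x assume x: "x \<in> {x \<in> space M. ereal s < \<bar>f x\<bar>}"
      then obtain r where r: "ereal s < ereal r" "ereal r < \<bar>f x\<bar>"
        using ereal_dense2[of "ereal s" "\<bar>f x\<bar>"] by auto
      then obtain n where "1 / Suc n < r - s"
        using nat_approx_posE[of "r - s"] by auto
      then have "ereal (s + 1 / Suc n) < \<bar>f x\<bar>"
        using r by (intro less_trans[OF _ r(2)]) auto
      then show "x \<in> (\<Union>n. {x \<in> space M. ereal (s + 1 / Suc n) < \<bar>f x\<bar>})"
        using x by auto
    next
      fix x assume "x \<in> (\<Union>n. {x \<in> space M. ereal (s + 1 / Suc n) < \<bar>f x\<bar>})"
      then obtain n where "x \<in> space M" "ereal (s + 1 / Suc n) < \<bar>f x\<bar>"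
        by blast
      moreover have "ereal s \<le> ereal (s + 1 / Suc n)"
        by simp
      ultimately show "x \<in> {x \<in> space M. ereal s < \<bar>f x\<bar>}"
        by (blast intro: le_less_trans)
    qed
    finally show ?thesis
      by (simp add: distr_fun_def)
  qed
  then obtain n where n: "ennreal t < distr_fun M f (s + 1 / Suc n)"
    using less by (auto simp: less_SUP_iff)
  have "ennreal (s + 1 / Suc n) \<le> ennreal v" if v: "distr_fun M f v \<le> ennreal t" for v
  proof (rule ccontr)
    assume "\<not> ?thesis"
    then have "v \<le> s + 1 / Suc n"
      by (meson ennreal_leI linear)
    then show False
      using distr_fun_antimono[OF assms(1), of v "s + 1 / Suc n"] n v by auto
  qed
  then have "ennreal (s + 1 / Suc n) \<le> decr_rearr M f t"
    unfolding decr_rearr_def by (rule INF_greatest) blast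
  moreover have "ennreal s < ennreal (s + 1 / Suc n)"
    using \<open>0 \<le> s\<close> by (intro ennreal_lessI) (auto intro: add_nonneg_pos)
  ultimately show "ennreal s < decr_rearr M f t"
    by (rule less_le_trans[rotated])
qed

text \<open>
  The integral of \<open>s\<^sup>a\<^sup>-\<^sup>1\<close> over \<open>(0,c)\<close>, written with an indicator so that \<open>c = \<infinity>\<close> is included and that
  the formula applies to either order of integration in the double integral below.
\<close>

lemma nn_integral_powr_below:
  fixes a :: real and c :: ennreal
  assumes "0 < a"
  shows "(\<integral>\<^sup>+s. ennreal (s powr (a - 1)) * indicator {s. 0 < s \<and> ennreal s < c} s \<partial>lborel)
    = ennreal (1 / a) * c epowr a"
proof -
  have fin: "(\<integral>\<^sup>+s. ennreal (s powr (a - 1)) * indicator {s. 0 < s \<and> ennreal s < ennreal b} s \<partial>lborel)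
      = ennreal (1 / a) * ennreal b epowr a" if "0 \<le> b" for b
  proof -
    have "(\<integral>\<^sup>+s. ennreal (s powr (a - 1)) * indicator {s. 0 < s \<and> ennreal s < ennreal b} s \<partial>lborel)
        = (\<integral>\<^sup>+s. ennreal (s powr (a - 1)) * indicator {0..b} s \<partial>lborel)"
    proof (rule nn_integral_cong_AE)
      show "AE s in lborel. ennreal (s powr (a - 1)) * indicator {s. 0 < s \<and> ennreal s < ennreal b} s
          = ennreal (s powr (a - 1)) * indicator {0..b} s"
        using AE_lborel_singleton[of 0] AE_lborel_singleton[of b]
        by eventually_elim (use that in \<open>auto simp: indicator_def ennreal_less_iff\<close>)
    qed
    also have "\<dots> = ennreal (b powr a / a)"
      using has_integral_powr_from_0[of "a - 1" b] assms that
      by (intro nn_integral_has_integral_lebesgue') auto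
    finally show ?thesis
      using assms that by (simp add: epowr_ennreal flip: ennreal_mult)
  qed
  show ?thesis
  proof (cases c)
    case top
    have "ennreal (1 / a) * ennreal (real n) epowr a
        \<le> (\<integral>\<^sup>+s. ennreal (s powr (a - 1)) * indicator {s. 0 < s \<and> ennreal s < c} s \<partial>lborel)" for n
      unfolding fin[OF of_nat_0_le_iff, symmetric]
      by (intro nn_integral_mono) (auto simp: indicator_def top)
    then have "(SUP n. ennreal (1 / a) * ennreal (real n) epowr a)
        \<le> (\<integral>\<^sup>+s. ennreal (s powr (a - 1)) * indicator {s. 0 < s \<and> ennreal s < c} s \<partial>lborel)"
      by (intro SUP_least)
    moreover have "(SUP n. ennreal (1 / a) * ennreal (real n) epowr a) = top"
      using assms
      by (simp add: SUP_mult_left_ennreal[symmetric] epowr_SUP[symmetric] ennreal_SUP_of_nat_eq_top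
          ennreal_of_nat_eq_real_of_nat[symmetric] ennreal_mult_top)
    ultimately show ?thesis
      using top assms by (simp add: top_unique ennreal_mult_top)
  qed (use fin in auto)
qed

lemma decr_rearr_measurable:
  assumes "f \<in> borel_measurable M"
  shows "decr_rearr M f \<in> borel_measurable borel"
proof (rule borel_measurableI_greater)
  fix y show "{t \<in> space borel. y < decr_rearr M f t} \<in> sets borel"
    by (cases y) (auto simp: less_decr_rearr_iff[OF assms])
qed

text \<open>
  Both sides are, up to the factor \<open>a q\<close>, the integral of \<open>t\<^sup>a\<^sup>-\<^sup>1 s\<^sup>q\<^sup>-\<^sup>1\<close> over the region under the graph of
  the distribution function. By the inverse relation it is also the region under the graph of the
  decreasing rearrangement, so Tonelli's theorem gives the identity.
\<close>

theorem layer_cake_decr_rearr: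
  assumes f: "f \<in> borel_measurable M" and "0 < a" and "0 < q"
  shows "ennreal a * (\<integral>\<^sup>+t\<in>{0<..}. ennreal (t powr (a - 1)) * decr_rearr M f t epowr q \<partial>lborel)
    = ennreal q * (\<integral>\<^sup>+s\<in>{0<..}. ennreal (s powr (q - 1)) * distr_fun M f s epowr a \<partial>lborel)"
proof -
  note [measurable] = decr_rearr_measurable[OF f] borel_measurable_distr_fun[OF f]
  define K where "K = (\<lambda>t s. ennreal (t powr (a - 1)) * ennreal (s powr (q - 1)) *
    indicator {(t, s). 0 < t \<and> 0 < s \<and> ennreal t < distr_fun M f s} (t, s))"
  have [measurable]: "(\<lambda>(t, s). K t s) \<in> borel_measurable (lborel \<Otimes>\<^sub>M lborel)"
    unfolding K_def by measurable
  have 1: "(\<integral>\<^sup>+s. K t s \<partial>lborel)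
      = ennreal (1 / q) * (ennreal (t powr (a - 1)) * decr_rearr M f t epowr q * indicator {0<..} t)" for t
  proof -
    have "K t s = ennreal (t powr (a - 1)) * indicator {0<..} t *
        (ennreal (s powr (q - 1)) * indicator {s. 0 < s \<and> ennreal s < decr_rearr M f t} s)" for s
      unfolding K_def by (auto simp: indicator_def less_decr_rearr_iff[OF f])
    then show ?thesis
      using \<open>0 < q\<close> by (simp add: nn_integral_cmult nn_integral_powr_below mult_ac(1)) (simp add: mult_ac)
  qed
  have 2: "(\<integral>\<^sup>+t. K t s \<partial>lborel)
      = ennreal (1 / a) * (ennreal (s powr (q - 1)) * distr_fun M f s epowr a * indicator {0<..} s)" for s
  proof -
    have "K t s = ennreal (s powr (q - 1)) * indicator {0<..} s *
        (ennreal (t powr (a - 1)) * indicator {t. 0 < t \<and> ennreal t < distr_fun M f s} t)" for t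
      unfolding K_def by (auto simp: indicator_def ac_simps)
    then show ?thesis
      using \<open>0 < a\<close> by (simp add: nn_integral_cmult nn_integral_powr_below mult_ac(1)) (simp add: mult_ac)
  qed
  have "(\<integral>\<^sup>+t. \<integral>\<^sup>+s. K t s \<partial>lborel \<partial>lborel) = (\<integral>\<^sup>+s. \<integral>\<^sup>+t. K t s \<partial>lborel \<partial>lborel)"
    by (rule lborel_pair.Fubini') measurable
  then have "ennreal (1 / q) * (\<integral>\<^sup>+t\<in>{0<..}. ennreal (t powr (a - 1)) * decr_rearr M f t epowr q \<partial>lborel)
      = ennreal (1 / a) * (\<integral>\<^sup>+s\<in>{0<..}. ennreal (s powr (q - 1)) * distr_fun M f s epowr a \<partial>lborel)"
    unfolding 1 2 by (simp add: nn_integral_cmult)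
  then have "ennreal (a * q) * (ennreal (1 / q) * (\<integral>\<^sup>+t\<in>{0<..}. ennreal (t powr (a - 1)) * decr_rearr M f t epowr q \<partial>lborel))
      = ennreal (a * q) * (ennreal (1 / a) * (\<integral>\<^sup>+s\<in>{0<..}. ennreal (s powr (q - 1)) * distr_fun M f s epowr a \<partial>lborel))"
    by simp
  then show ?thesis
    using assms by (simp add: mult.assoc[symmetric] flip: ennreal_mult)
qed

section \<open>Lorentz quasinorms and countable suprema\<close>

text \<open>
  The measure \<open>p s\<^sup>q\<^sup>-\<^sup>1 ds\<close> on \<open>(0,\<infinity>)\<close>. Absorbing the weight into a measure lets the results on
  integrals be applied to the distribution functions themselves.
\<close>

definition lorentz_weight :: "real \<Rightarrow> real \<Rightarrow> real measure"
  where "lorentz_weight p q =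
    density lborel (\<lambda>s. ennreal p * ennreal (s powr (q - 1)) * indicator {0<..} s)"

lemma sets_lorentz_weight [simp, measurable_cong]: "sets (lorentz_weight p q) = sets borel"
  by (simp add: lorentz_weight_def)

text \<open>
  The reason for passing from the rearrangement to the distribution function is that the latter is
  countably subadditive under suprema, whereas the rearrangement is not.
\<close>

lemma lorentz_norm_eq_nn_integral_distr_fun:
  assumes f: "f \<in> borel_measurable M" and "0 < p" and "0 < q"
  shows "lorentz_norm M p (ennreal q) f
    = (\<integral>\<^sup>+s. distr_fun M f s epowr (q / p) \<partial>lorentz_weight p q) epowr (1 / q)"
proof -
  note [measurable] = borel_measurable_distr_fun[OF f]
  define I J where "I = (\<integral>\<^sup>+t\<in>{0<..}. ennreal (t powr (q / p - 1)) * decr_rearr M f t epowr q \<partial>lborel)"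
    and "J = (\<integral>\<^sup>+s\<in>{0<..}. ennreal (s powr (q - 1)) * distr_fun M f s epowr (q / p) \<partial>lborel)"
  have "(ennreal (t powr (1 / p)) * decr_rearr M f t) epowr q / ennreal t
      = ennreal (t powr (q / p - 1)) * decr_rearr M f t epowr q" if "0 < t" for t
  proof -
    have "(ennreal (t powr (1 / p)) * decr_rearr M f t) epowr q / ennreal t
        = ennreal (t powr (q / p)) / ennreal t * decr_rearr M f t epowr q"
      using \<open>0 < q\<close> by (simp add: epowr_mult epowr_ennreal powr_powr ennreal_times_divide mult.commute)
    also have "ennreal (t powr (q / p)) / ennreal t = ennreal (t powr (q / p - 1))"
      using that by (simp add: divide_ennreal powr_diff)
    finally show ?thesis .
  qed
  then have "lorentz_norm M p (ennreal q) f = I epowr (1 / q)"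
    unfolding lorentz_norm_def I_def using \<open>0 < q\<close>
    by (auto intro!: arg_cong[where f = "\<lambda>x. x epowr (1 / q)"] nn_integral_cong simp: indicator_def)
  also have "I = ennreal p * J"
  proof -
    have "ennreal (p / q) * (ennreal (q / p) * I) = ennreal (p / q) * (ennreal q * J)"
      using layer_cake_decr_rearr[OF f, of "q / p" q] assms by (simp add: I_def J_def)
    then show ?thesis
      using assms by (simp add: mult.assoc[symmetric] flip: ennreal_mult)
  qed
  also have "\<dots> = (\<integral>\<^sup>+s. distr_fun M f s epowr (q / p) \<partial>lorentz_weight p q)"
    unfolding lorentz_weight_def J_def
    by (simp add: nn_integral_density nn_integral_cmult[symmetric] mult_ac)
  finally show ?thesis .
qed

lemma lorentz_norm_top_epowr:
  assumes "0 < p"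
  shows "lorentz_norm M p \<infinity> f epowr p = (SUP t\<in>{0<..}. ennreal (t powr p) * distr_fun M f t)"
  using assms
  by (auto simp: lorentz_norm_def epowr_SUP epowr_mult epowr_inverse epowr_ennreal intro!: SUP_cong)

lemma distr_fun_SUP_le:
  fixes \<rho> :: "nat \<Rightarrow> 'a \<Rightarrow> ennreal"
  assumes [measurable]: "\<And>i. \<rho> i \<in> borel_measurable M"
  shows "distr_fun M (\<lambda>x. enn2ereal (SUP i. \<rho> i x)) t \<le> (\<Sum>i. distr_fun M (\<lambda>x. enn2ereal (\<rho> i x)) t)"
proof -
  have less: "ereal t < \<bar>enn2ereal z\<bar> \<longleftrightarrow> t < 0 \<or> ennreal t < z" for z
    by (cases z; cases "0 \<le> t") (auto simp: ennreal_less_iff)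
  have "distr_fun M (\<lambda>x. enn2ereal (SUP i. \<rho> i x)) t
      = emeasure M (\<Union>i. {x \<in> space M. ereal t < \<bar>enn2ereal (\<rho> i x)\<bar>})"
    unfolding distr_fun_def less by (intro arg_cong[where f = "emeasure M"]) (auto simp: less_SUP_iff)
  also have "\<dots> \<le> (\<Sum>i. emeasure M {x \<in> space M. ereal t < \<bar>enn2ereal (\<rho> i x)\<bar>})"
    by (rule emeasure_subadditive_countably) auto
  finally show ?thesis
    by (simp add: distr_fun_def)
qed

text \<open>
  For \<open>q \<le> p\<close> the exponent \<open>q / p\<close> is at most \<open>1\<close>, so subadditivity of \<open>t \<mapsto> t\<^sup>q\<^sup>/\<^sup>p\<close> passes from the
  distribution functions to the integrand.
\<close>

proposition lorentz_norm_SUP_epowr_q_le: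
  fixes \<rho> :: "nat \<Rightarrow> 'a \<Rightarrow> ennreal"
  assumes \<rho> [measurable]: "\<And>i. \<rho> i \<in> borel_measurable M" and "0 < q" and "q \<le> p"
  shows "lorentz_norm M p (ennreal q) (\<lambda>x. enn2ereal (SUP i. \<rho> i x)) epowr q
    \<le> (\<Sum>i. lorentz_norm M p (ennreal q) (\<lambda>x. enn2ereal (\<rho> i x)) epowr q)"
proof -
  have [measurable]: "distr_fun M (\<lambda>x. enn2ereal (\<rho> i x)) \<in> borel_measurable borel" for i
    by (rule borel_measurable_distr_fun) measurable
  have eq: "lorentz_norm M p (ennreal q) (\<lambda>x. enn2ereal (g x)) epowr q
      = (\<integral>\<^sup>+s. distr_fun M (\<lambda>x. enn2ereal (g x)) s epowr (q / p) \<partial>lorentz_weight p q)"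
    if [measurable]: "g \<in> borel_measurable M" for g
    using assms by (subst lorentz_norm_eq_nn_integral_distr_fun) (auto simp: epowr_inverse)
  have "distr_fun M (\<lambda>x. enn2ereal (SUP i. \<rho> i x)) s epowr (q / p)
      \<le> (\<Sum>i. distr_fun M (\<lambda>x. enn2ereal (\<rho> i x)) s epowr (q / p))" for s
    using assms
    by (intro order_trans[OF epowr_mono[OF distr_fun_SUP_le] epowr_suminf_le]) auto
  then have "(\<integral>\<^sup>+s. distr_fun M (\<lambda>x. enn2ereal (SUP i. \<rho> i x)) s epowr (q / p) \<partial>lorentz_weight p q)
      \<le> (\<integral>\<^sup>+s. (\<Sum>i. distr_fun M (\<lambda>x. enn2ereal (\<rho> i x)) s epowr (q / p)) \<partial>lorentz_weight p q)"
    by (intro nn_integral_mono)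
  also have "\<dots> = (\<Sum>i. \<integral>\<^sup>+s. distr_fun M (\<lambda>x. enn2ereal (\<rho> i x)) s epowr (q / p) \<partial>lorentz_weight p q)"
    by (rule nn_integral_suminf) measurable
  finally show ?thesis
    by (simp add: eq)
qed

text \<open>
  For finite \<open>q \<ge> p\<close> the quantity raised to the power \<open>p\<close> is the \<open>L\<^sup>q\<^sup>/\<^sup>p\<close> norm of the distribution
  function with respect to \<^const>\<open>lorentz_weight\<close>, and the claim is Minkowski's inequality. For
  \<open>q = \<infinity>\<close> a supremum takes the place of this norm.
\<close>

proposition lorentz_norm_SUP_epowr_p_le:
  fixes \<rho> :: "nat \<Rightarrow> 'a \<Rightarrow> ennreal"
  assumes \<rho> [measurable]: "\<And>i. \<rho> i \<in> borel_measurable M" and "0 < p" and "ennreal p \<le> q"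
  shows "lorentz_norm M p q (\<lambda>x. enn2ereal (SUP i. \<rho> i x)) epowr p
    \<le> (\<Sum>i. lorentz_norm M p q (\<lambda>x. enn2ereal (\<rho> i x)) epowr p)"
proof (cases q)
  case (real r)
  then have r: "p \<le> r" "0 < r"
    using assms by auto
  have [measurable]: "distr_fun M (\<lambda>x. enn2ereal (\<rho> i x)) \<in> borel_measurable borel" for i
    by (rule borel_measurable_distr_fun) measurable
  have eq: "lorentz_norm M p q (\<lambda>x. enn2ereal (g x)) epowr p
      = (\<integral>\<^sup>+s. distr_fun M (\<lambda>x. enn2ereal (g x)) s epowr (r / p) \<partial>lorentz_weight p r) epowr (1 / (r / p))"
    if [measurable]: "g \<in> borel_measurable M" for g
    unfolding real using assms r
    by (subst lorentz_norm_eq_nn_integral_distr_fun) (auto simp: epowr_epowr)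
  have "lorentz_norm M p q (\<lambda>x. enn2ereal (SUP i. \<rho> i x)) epowr p
      \<le> (\<integral>\<^sup>+s. (\<Sum>i. distr_fun M (\<lambda>x. enn2ereal (\<rho> i x)) s) epowr (r / p) \<partial>lorentz_weight p r) epowr (1 / (r / p))"
    unfolding eq[OF borel_measurable_SUP[OF countableI_type \<rho>]] using assms r
    by (intro epowr_mono nn_integral_mono distr_fun_SUP_le) auto
  also have "\<dots> \<le> (\<Sum>i. (\<integral>\<^sup>+s. distr_fun M (\<lambda>x. enn2ereal (\<rho> i x)) s epowr (r / p) \<partial>lorentz_weight p r) epowr (1 / (r / p)))"
    using assms r by (intro minkowski_suminf) auto
  finally show ?thesis
    by (simp add: eq)
next
  case top
  have "ennreal (t powr p) * distr_fun M (\<lambda>x. enn2ereal (SUP i. \<rho> i x)) t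
      \<le> (\<Sum>i. SUP t\<in>{0<..}. ennreal (t powr p) * distr_fun M (\<lambda>x. enn2ereal (\<rho> i x)) t)"
    if "0 < t" for t
  proof -
    have "ennreal (t powr p) * distr_fun M (\<lambda>x. enn2ereal (SUP i. \<rho> i x)) t
        \<le> ennreal (t powr p) * (\<Sum>i. distr_fun M (\<lambda>x. enn2ereal (\<rho> i x)) t)"
      by (intro mult_left_mono distr_fun_SUP_le) auto
    also have "\<dots> = (\<Sum>i. ennreal (t powr p) * distr_fun M (\<lambda>x. enn2ereal (\<rho> i x)) t)"
      by simp
    also have "\<dots> \<le> (\<Sum>i. SUP t\<in>{0<..}. ennreal (t powr p) * distr_fun M (\<lambda>x. enn2ereal (\<rho> i x)) t)"
      using that by (intro suminf_le summableI SUP_upper) auto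
    finally show ?thesis .
  qed
  then show ?thesis
    unfolding top infinity_ennreal_def[symmetric] lorentz_norm_top_epowr[OF \<open>0 < p\<close>]
    by (intro SUP_least) auto
qed

lemma lorentz_norm_zero:
  assumes "0 < p" and "0 < q"
  shows "lorentz_norm M p q (\<lambda>x. 0) = 0"
proof (cases q)
  case (real r)
  then have "lorentz_norm M p q (\<lambda>x. 0)
      = (\<integral>\<^sup>+s. distr_fun M (\<lambda>x. 0) s epowr (r / p) \<partial>lorentz_weight p r) epowr (1 / r)"
    using lorentz_norm_eq_nn_integral_distr_fun[of "\<lambda>x. 0" M p r] assms by simp
  also have "(\<integral>\<^sup>+s. distr_fun M (\<lambda>x. 0) s epowr (r / p) \<partial>lorentz_weight p r) = 0"
  proof -
    have "(\<integral>\<^sup>+s. distr_fun M (\<lambda>x. 0) s epowr (r / p) \<partial>lorentz_weight p r) =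
        (\<integral>\<^sup>+s. ennreal p * ennreal (s powr (r - 1)) * indicator {0<..} s
          * distr_fun M (\<lambda>x. 0) s epowr (r / p) \<partial>lborel)"
      unfolding lorentz_weight_def
      by (rule nn_integral_density) (auto intro!: measurable_epowr borel_measurable_distr_fun)
    also have "\<dots> = (\<integral>\<^sup>+s. 0 \<partial>(lborel :: real measure))"
      by (intro nn_integral_cong) (auto simp: indicator_def distr_fun_def)
    finally show ?thesis
      by simp
  qed
  finally show ?thesis
    by simp
next
  case top
  then show ?thesis
    by (auto simp: lorentz_norm_def distr_fun_def SUP_constant intro!: antisym SUP_least)
qed

section \<open>The modulus\<close>

lemma Mod_pq_mono: "\<Gamma>\<^sub>1 \<subseteq> \<Gamma>\<^sub>2 \<Longrightarrow> Mod_pq M p q \<Gamma>\<^sub>1 \<le> Mod_pq M p q \<Gamma>\<^sub>2"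
  unfolding Mod_pq_def by (rule INF_superset_mono) (auto simp: admissible_def)

lemma Mod_pq_empty:
  assumes "0 < p" and "0 < q"
  shows "Mod_pq M p q {} = 0"
proof -
  have "Mod_pq M p q {} \<le> lorentz_norm M p q (\<lambda>x. enn2ereal 0) epowr p"
    unfolding Mod_pq_def by (rule INF_lower) (simp add: admissible_def)
  then show ?thesis
    by (simp add: lorentz_norm_zero[OF assms] zero_ennreal.rep_eq)
qed

lemma SUP_mem_admissible_UN:
  fixes \<rho> :: "nat \<Rightarrow> 'a::metric_space \<Rightarrow> ennreal"
  assumes "\<And>i. \<rho> i \<in> admissible (\<Gamma> i)"
  shows "(\<lambda>x. SUP i. \<rho> i x) \<in> admissible (\<Union>i. \<Gamma> i)"
  unfolding admissible_def
proof (intro CollectI conjI ballI)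
  show "(\<lambda>x. SUP i. \<rho> i x) \<in> borel_measurable borel"
    using assms by (intro borel_measurable_SUP) (auto simp: admissible_def)
  fix g assume "g \<in> (\<Union>i. \<Gamma> i)"
  then obtain i where "g \<in> \<Gamma> i"
    by blast
  then have "1 \<le> line_integral g (\<rho> i)"
    using assms[of i] by (auto simp: admissible_def)
  also have "\<dots> \<le> line_integral g (\<lambda>x. SUP i. \<rho> i x)"
    unfolding line_integral_def by (intro nn_integral_mono mult_right_mono SUP_upper) auto
  finally show "1 \<le> line_integral g (\<lambda>x. SUP i. \<rho> i x)" .
qed

text \<open>
  The common core of both subadditivity statements: near-optimal densities for the single families,
  with errors summing to \<open>e\<close>, are combined by their pointwise supremum.
\<close>

lemma INF_admissible_UN_le:
  fixes N :: "('a::metric_space \<Rightarrow> ennreal) \<Rightarrow> ennreal" and \<Gamma> :: "nat \<Rightarrow> (real \<Rightarrow> 'a) set"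
  assumes "\<And>\<rho>. (\<And>i. \<rho> i \<in> borel_measurable borel) \<Longrightarrow> N (\<lambda>x. SUP i::nat. \<rho> i x) \<le> (\<Sum>i. N (\<rho> i))"
  shows "(INF \<rho>\<in>admissible (\<Union>i. \<Gamma> i). N \<rho>) \<le> (\<Sum>i. INF \<rho>\<in>admissible (\<Gamma> i). N \<rho>)"
proof (rule ennreal_le_epsilon)
  fix e :: real
  assume fin: "(\<Sum>i. INF \<rho>\<in>admissible (\<Gamma> i). N \<rho>) < top" and "0 < e"
  have "\<exists>\<rho>\<in>admissible (\<Gamma> i). N \<rho> \<le> (INF \<rho>\<in>admissible (\<Gamma> i). N \<rho>) + ennreal (e * (1 / 2) ^ Suc i)" for i
  proof -
    have "(INF \<rho>\<in>admissible (\<Gamma> i). N \<rho>) < top"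
      using fin by (rule ennreal_suminf_lessD)
    then obtain m where "(INF \<rho>\<in>admissible (\<Gamma> i). N \<rho>) = ennreal m" "0 \<le> m"
      by (auto simp: less_top_ennreal)
    then have "(INF \<rho>\<in>admissible (\<Gamma> i). N \<rho>) < (INF \<rho>\<in>admissible (\<Gamma> i). N \<rho>) + ennreal (e * (1 / 2) ^ Suc i)"
      using \<open>0 < e\<close> by (auto simp: ennreal_less_iff simp flip: ennreal_plus)
    then show ?thesis
      by (auto simp: INF_less_iff intro: less_imp_le)
  qed
  then obtain \<rho> where \<rho>: "\<And>i. \<rho> i \<in> admissible (\<Gamma> i)"
      "\<And>i. N (\<rho> i) \<le> (INF \<rho>\<in>admissible (\<Gamma> i). N \<rho>) + ennreal (e * (1 / 2) ^ Suc i)"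
    by metis
  have "(INF \<rho>\<in>admissible (\<Union>i. \<Gamma> i). N \<rho>) \<le> N (\<lambda>x. SUP i. \<rho> i x)"
    using \<rho>(1) by (intro INF_lower SUP_mem_admissible_UN)
  also have "\<dots> \<le> (\<Sum>i. N (\<rho> i))"
    using \<rho>(1) by (intro assms) (auto simp: admissible_def)
  also have "\<dots> \<le> (\<Sum>i. (INF \<rho>\<in>admissible (\<Gamma> i). N \<rho>) + ennreal (e * (1 / 2) ^ Suc i))"
    by (intro suminf_le summableI \<rho>(2))
  also have "\<dots> = (\<Sum>i. INF \<rho>\<in>admissible (\<Gamma> i). N \<rho>) + (\<Sum>i. ennreal (e * (1 / 2) ^ Suc i))"
    by (intro suminf_add[symmetric] summableI)
  also have "(\<Sum>i. ennreal (e * (1 / 2) ^ Suc i)) = ennreal e"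
    using sums_mult[OF power_half_series, of e] \<open>0 < e\<close> by (intro suminf_ennreal_eq) auto
  finally show "(INF \<rho>\<in>admissible (\<Union>i. \<Gamma> i). N \<rho>) \<le> (\<Sum>i. INF \<rho>\<in>admissible (\<Gamma> i). N \<rho>) + ennreal e" .
qed

text \<open>
  The exponent \<open>b\<close> is moved inside the infimum over densities, which turns the claim into one about
  the \<open>p b\<close>-th power of the quasinorm. Later \<open>b\<close> is \<open>q / p\<close> or \<open>1\<close>.
\<close>

lemma Mod_pq_UN_epowr_le:
  fixes M :: "'a::metric_space measure" and \<Gamma> :: "nat \<Rightarrow> (real \<Rightarrow> 'a) set"
  assumes "borel_regular M" and "0 < b"
    and "\<And>\<rho> :: nat \<Rightarrow> 'a \<Rightarrow> ennreal. (\<And>i. \<rho> i \<in> borel_measurable M) \<Longrightarrow>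
      lorentz_norm M p q (\<lambda>x. enn2ereal (SUP i. \<rho> i x)) epowr (p * b)
        \<le> (\<Sum>i. lorentz_norm M p q (\<lambda>x. enn2ereal (\<rho> i x)) epowr (p * b))"
  shows "Mod_pq M p q (\<Union>i. \<Gamma> i) epowr b \<le> (\<Sum>i. Mod_pq M p q (\<Gamma> i) epowr b)"
proof -
  have borel: "f \<in> borel_measurable M" if "f \<in> borel_measurable borel" for f :: "'a \<Rightarrow> ennreal"
    using that assms(1) by (intro borel_measurable_subalgebra[of borel M]) (auto simp: borel_regular_def)
  show ?thesis
    unfolding Mod_pq_def epowr_INF[OF \<open>0 < b\<close>] epowr_epowr
    by (intro INF_admissible_UN_le assms(3) borel)
qed

theorem theorem3p2:
  fixes M :: "'a::complete_space measure" and p :: real and q :: ennreal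
  assumes "borel_regular M"
    and "emeasure M UNIV \<noteq> 0"
    and "\<And>U. open U \<Longrightarrow> bounded U \<Longrightarrow> U \<noteq> {} \<Longrightarrow> 0 < emeasure M U \<and> emeasure M U < \<infinity>"
    and "1 < p" and "1 \<le> q"
  shows
    "Mod_pq M p q {} = 0
     \<and> (\<forall>\<Gamma>\<^sub>1 \<Gamma>\<^sub>2. \<Gamma>\<^sub>1 \<subseteq> \<Gamma>\<^sub>2 \<and> \<Gamma>\<^sub>2 \<subseteq> Gamma_rect \<longrightarrow> Mod_pq M p q \<Gamma>\<^sub>1 \<le> Mod_pq M p q \<Gamma>\<^sub>2)
     \<and> (q \<le> ennreal p \<longrightarrow>
         (\<forall>\<Gamma> :: nat \<Rightarrow> (real \<Rightarrow> 'a) set. (\<forall>i. \<Gamma> i \<subseteq> Gamma_rect) \<longrightarrow>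
           Mod_pq M p q (\<Union>i. \<Gamma> i) epowr (enn2real q / p)
             \<le> (\<Sum>i. Mod_pq M p q (\<Gamma> i) epowr (enn2real q / p))))
     \<and> (ennreal p < q \<longrightarrow>
         (\<forall>\<Gamma> :: nat \<Rightarrow> (real \<Rightarrow> 'a) set. (\<forall>i. \<Gamma> i \<subseteq> Gamma_rect) \<longrightarrow>
           Mod_pq M p q (\<Union>i. \<Gamma> i) \<le> (\<Sum>i. Mod_pq M p q (\<Gamma> i))))"
proof (intro conjI allI impI)
  have "0 < q"
    using \<open>1 \<le> q\<close> by (rule less_le_trans[OF zero_less_one])
  then show "Mod_pq M p q {} = 0"
    using \<open>1 < p\<close> by (intro Mod_pq_empty) auto
next
  fix \<Gamma>\<^sub>1 \<Gamma>\<^sub>2 :: "(real \<Rightarrow> 'a) set"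
  assume "\<Gamma>\<^sub>1 \<subseteq> \<Gamma>\<^sub>2 \<and> \<Gamma>\<^sub>2 \<subseteq> Gamma_rect"
  then show "Mod_pq M p q \<Gamma>\<^sub>1 \<le> Mod_pq M p q \<Gamma>\<^sub>2"
    by (intro Mod_pq_mono) simp
next
  fix \<Gamma> :: "nat \<Rightarrow> (real \<Rightarrow> 'a) set"
  assume "q \<le> ennreal p"
  then obtain r where r: "q = ennreal r" "0 \<le> r"
    by (cases q) (auto simp: top_unique)
  then have "0 < r" "r \<le> p"
    using \<open>q \<le> ennreal p\<close> assms(4,5) by (auto simp: ennreal_le_iff2)
  then show "Mod_pq M p q (\<Union>i. \<Gamma> i) epowr (enn2real q / p)
      \<le> (\<Sum>i. Mod_pq M p q (\<Gamma> i) epowr (enn2real q / p))"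
    using assms(1) r lorentz_norm_SUP_epowr_q_le[of _ M r p]
    by (intro Mod_pq_UN_epowr_le) auto
next
  fix \<Gamma> :: "nat \<Rightarrow> (real \<Rightarrow> 'a) set"
  assume "ennreal p < q"
  then show "Mod_pq M p q (\<Union>i. \<Gamma> i) \<le> (\<Sum>i. Mod_pq M p q (\<Gamma> i))"
    using Mod_pq_UN_epowr_le[of M 1 p q \<Gamma>] lorentz_norm_SUP_epowr_p_le[of _ M p q] assms(1,4)
    by simp
qed

end
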